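(* Let $(X,\epsilon,\eta,\delta,\mu)$ be a Frobenius object in $\mathbf{Rel}$ with associated bijection $\hat\alpha:X\to X$, and let $\mathcal X$ be its associated $2$-coskeletal simplicial set, with $X_1=X$ and $X_2=\mu$ regarded as a subset of $(X_1)^3$ via $\zeta\mapsto(d_2^2\zeta,d_0^2\zeta,d_1^2\zeta)$. Then $X_2$ is invariant under the $\mathbb Z$-action on $(X_1)^3$ generated by the rotation action of $\hat\alpha$, $(x,y,z)\mapsto(y,\hat\alpha(z),\hat\alpha(x))$.
   Context: In the category $\mathbf{Rel}$, objects are sets, a morphism $S:X\dashrightarrow Y$ is a subset $S\subseteq X\times Y$, composition is $T\circ S=\{(x,z)\mid \exists y:\ (x,y)\in S,\ (y,z)\in T\}$, the identity $\mathbf{1}$ is the diagonal, and $S\times T$ denotes the product relation (with $\{\bullet\}\times X\cong X\cong X\times\{\bullet\}$ identified). A Frobenius object in $\mathbf{Rel}$ is a set $X$ with morphisms $\epsilon:X\dashrightarrow\{\bullet\}$, $\eta:\{\bullet\}\dashrightarrow X$, $\delta:X\dashrightarrow X\times X$, $\mu:X\times X\dashrightarrow X$ such that (U) $\mu\circ(\eta\times\mathbf 1)=\mathbf 1=\mu\circ(\mathbf 1\times\eta)$; (C) $(\epsilon\times\mathbf 1)\circ\delta=\mathbf 1=(\mathbf 1\times\epsilon)\circ\delta$; (F) $(\mathbf 1\times\mu)\circ(\delta\times\mathbf 1)=\delta\circ\mu=(\mu\times\mathbf 1)\circ(\mathbf 1\times\delta)$. We view $\epsilon,\eta\subseteq X$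 and $\delta,\mu\subseteq X^3$; $(x,y,z)\in\mu$ has inputs $x,y$ and output $z$; $(x,y,z)\in\delta$ has input $x$ and outputs $y,z$. The bijection $\hat\alpha:X\to X$ is the unique map with $\epsilon\circ\mu=\{(x,\hat\alpha(x))\mid x\in X\}\subseteq X\times X$ (where $\epsilon\circ\mu:X\times X\dashrightarrow\{\bullet\}$). Source and target maps $s,t:X\to\eta$: $s(x)$ is the unique element of $\eta$ with $(x,s(x),x)\in\mu$, and $t(x)$ the unique element of $\eta$ with $(t(x),x,x)\in\mu$. Associated simplicial set: $X_0=\eta$, $X_1=X$, $X_2=\mu$; $s_0^0$ is the inclusion; $d_0^1=s$, $d_1^1=t$; $s_0^1(x)=(t(x),x,x)$, $s_1^1(x)=(x,s(x),x)$; $d_0^2(x,y,z)=y$, $d_1^2(x,y,z)=z$, $d_2^2(x,y,z)=x$; $\mathcal X$ is the unique $2$-coskeletal extension of this $2$-truncated simplicial set. *)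

theory Defs
  imports
    "HOL-Algebra.Elementary_Groups"
    "HOL-Algebra.Group_Action"
begin

section \<open>Frobenius objects in Rel\<close>

text \<open>
  A morphism from \<open>X\<close> to \<open>Y\<close> in Rel is a term of type \<open>('a \<times> 'b) set\<close> contained in \<open>X \<times> Y\<close>.
  The library's relation composition \<open>O\<close> is in diagrammatic order: the composite written
  \<open>T \<circ> S\<close> in the literature is \<open>S O T\<close>. The identity of \<open>X\<close> is \<open>Id_on X\<close>, and the one-point
  set is \<open>UNIV :: unit set\<close>. The identifications of \<open>{\<bullet>} \<times> X\<close> and \<open>X \<times> {\<bullet>}\<close> with \<open>X\<close>, and of
  \<open>(X \<times> X) \<times> X\<close> with \<open>X \<times> (X \<times> X)\<close>, are explicit relations.
\<close>

definition rel_times :: "('a \<times> 'b) set \<Rightarrow> ('c \<times> 'd) set \<Rightarrow> (('a \<times> 'c) \<times> ('b \<times> 'd)) set"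
    (infixr "\<boxtimes>" 80) where
  "S \<boxtimes> T = {((a, c), (b, d)) | a b c d. (a, b) \<in> S \<and> (c, d) \<in> T}"

definition lunitor :: "'a set \<Rightarrow> ((unit \<times> 'a) \<times> 'a) set" where
  "lunitor X = {(((), x), x) | x. x \<in> X}"

definition runitor :: "'a set \<Rightarrow> (('a \<times> unit) \<times> 'a) set" where
  "runitor X = {((x, ()), x) | x. x \<in> X}"

definition associator :: "'a set \<Rightarrow> ((('a \<times> 'a) \<times> 'a) \<times> ('a \<times> ('a \<times> 'a))) set" where
  "associator X = {(((x, y), z), (x, (y, z))) | x y z. x \<in> X \<and> y \<in> X \<and> z \<in> X}"

text \<open>
  The structure morphisms are stored as subsets of \<open>X\<close> and of \<open>X \<times> X \<times> X\<close>:
  \<open>(x, y, z) \<in> Mult\<close> has inputs \<open>x, y\<close> and output \<open>z\<close>, whereas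
  \<open>(x, y, z) \<in> Comult\<close> has input \<open>x\<close> and outputs \<open>y, z\<close>.
\<close>

record 'a frobenius_data =
  Carr :: "'a set"
  Counit :: "'a set"
  Unit :: "'a set"
  Comult :: "('a \<times> 'a \<times> 'a) set"
  Mult :: "('a \<times> 'a \<times> 'a) set"

definition counit_rel :: "'a frobenius_data \<Rightarrow> ('a \<times> unit) set" where
  "counit_rel F = {(x, ()) | x. x \<in> Counit F}"

definition unit_rel :: "'a frobenius_data \<Rightarrow> (unit \<times> 'a) set" where
  "unit_rel F = {((), x) | x. x \<in> Unit F}"

definition comult_rel :: "'a frobenius_data \<Rightarrow> ('a \<times> ('a \<times> 'a)) set" where
  "comult_rel F = {(x, (y, z)) | x y z. (x, y, z) \<in> Comult F}"

definition mult_rel :: "'a frobenius_data \<Rightarrow> (('a \<times> 'a) \<times> 'a) set" where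
  "mult_rel F = {((x, y), z) | x y z. (x, y, z) \<in> Mult F}"

definition frobenius_object :: "'a frobenius_data \<Rightarrow> bool" where
  "frobenius_object F \<longleftrightarrow>
    (let X = Carr F; \<epsilon> = counit_rel F; \<eta> = unit_rel F; \<delta> = comult_rel F; \<mu> = mult_rel F in
      Counit F \<subseteq> X \<and> Unit F \<subseteq> X \<and> Comult F \<subseteq> X \<times> X \<times> X \<and> Mult F \<subseteq> X \<times> X \<times> X \<and>
      (lunitor X)\<inverse> O (\<eta> \<boxtimes> Id_on X) O \<mu> = Id_on X \<and>
      (runitor X)\<inverse> O (Id_on X \<boxtimes> \<eta>) O \<mu> = Id_on X \<and>
      \<delta> O (\<epsilon> \<boxtimes> Id_on X) O lunitor X = Id_on X \<and>
      \<delta> O (Id_on X \<boxtimes> \<epsilon>) O runitor X = Id_on X \<and>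
      (\<delta> \<boxtimes> Id_on X) O associator X O (Id_on X \<boxtimes> \<mu>) = \<mu> O \<delta> \<and>
      (Id_on X \<boxtimes> \<delta>) O (associator X)\<inverse> O (\<mu> \<boxtimes> Id_on X) = \<mu> O \<delta>)"

text \<open>
  Restricting to extensional functions makes the map on \<open>X\<close> a unique HOL function.
\<close>

definition alpha_hat :: "'a frobenius_data \<Rightarrow> 'a \<Rightarrow> 'a" where
  "alpha_hat F = (THE f. f \<in> Carr F \<rightarrow>\<^sub>E Carr F \<and>
    {(x, y). ((x, y), ()) \<in> mult_rel F O counit_rel F} = {(x, f x) | x. x \<in> Carr F})"

definition source :: "'a frobenius_data \<Rightarrow> 'a \<Rightarrow> 'a" where
  "source F x = (THE u. u \<in> Unit F \<and> (x, u, x) \<in> Mult F)"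

definition target :: "'a frobenius_data \<Rightarrow> 'a \<Rightarrow> 'a" where
  "target F x = (THE u. u \<in> Unit F \<and> (u, x, x) \<in> Mult F)"


section \<open>Simplicial sets\<close>

text \<open>
  \<open>face S n i\<close> is the map \<open>d\<^sub>i\<close> from \<open>n\<close>-simplices to \<open>(n-1)\<close>-simplices, and \<open>degen S n i\<close> is the
  map \<open>s\<^sub>i\<close> from \<open>n\<close>-simplices to \<open>(n+1)\<close>-simplices. Values outside \<open>i \<le> n\<close> and
  outside the sets of simplices are irrelevant.
\<close>

record 'b sset =
  simplices :: "nat \<Rightarrow> 'b set"
  face :: "nat \<Rightarrow> nat \<Rightarrow> 'b \<Rightarrow> 'b"
  degen :: "nat \<Rightarrow> nat \<Rightarrow> 'b \<Rightarrow> 'b"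

definition truncated_simplicial_set :: "nat \<Rightarrow> 'b sset \<Rightarrow> bool" where
  "truncated_simplicial_set k S \<longleftrightarrow>
    (\<forall>n i. n < k \<and> i \<le> Suc n \<longrightarrow> face S (Suc n) i \<in> simplices S (Suc n) \<rightarrow> simplices S n) \<and>
    (\<forall>n i. n < k \<and> i \<le> n \<longrightarrow> degen S n i \<in> simplices S n \<rightarrow> simplices S (Suc n)) \<and>
    (\<forall>n i j x. Suc n < k \<and> i < j \<and> j \<le> Suc (Suc n) \<and> x \<in> simplices S (Suc (Suc n)) \<longrightarrow>
      face S (Suc n) i (face S (Suc (Suc n)) j x) =
      face S (Suc n) (j - 1) (face S (Suc (Suc n)) i x)) \<and>
    (\<forall>n i j x. Suc n < k \<and> i \<le> j \<and> j \<le> n \<and> x \<in> simplices S n \<longrightarrow>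
      degen S (Suc n) i (degen S n j x) = degen S (Suc n) (Suc j) (degen S n i x)) \<and>
    (\<forall>n i j x. n < k \<and> i \<le> Suc n \<and> j \<le> n \<and> x \<in> simplices S n \<longrightarrow>
      face S (Suc n) i (degen S n j x) =
        (if i < j then degen S (n - 1) (j - 1) (face S n i x)
         else if i \<le> Suc j then x
         else degen S (n - 1) j (face S n (i - 1) x)))"

definition simplicial_set :: "'b sset \<Rightarrow> bool" where
  "simplicial_set S \<longleftrightarrow> (\<forall>k. truncated_simplicial_set k S)"

text \<open>
  For \<open>n \<ge> 2\<close>, the lists \<open>[y\<^sub>0, \<dots>, y\<^sub>n]\<close> of \<open>(n-1)\<close>-simplices with matching faces are the
  maps from the boundary of the standard \<open>n\<close>-simplex; \<open>A\<close> is the set of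
  \<open>(n-1)\<close>-simplices and \<open>d\<close> its family of face maps.
\<close>

definition matching_families :: "nat \<Rightarrow> 'b set \<Rightarrow> (nat \<Rightarrow> 'b \<Rightarrow> 'b) \<Rightarrow> 'b list set" where
  "matching_families n A d = {ys. length ys = Suc n \<and> set ys \<subseteq> A \<and>
     (\<forall>i j. i < j \<and> j \<le> n \<longrightarrow> d i (ys ! j) = d (j - 1) (ys ! i))}"

text \<open>
  \<open>S\<close> is 2-coskeletal if every boundary of an \<open>n\<close>-simplex with \<open>n > 2\<close> has a unique filler.
\<close>

definition coskeletal2 :: "'b sset \<Rightarrow> bool" where
  "coskeletal2 S \<longleftrightarrow> simplicial_set S \<and>
    (\<forall>n>2. bij_betw (\<lambda>x. map (\<lambda>i. face S n i x) [0..<Suc n]) (simplices S n)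
             (matching_families n (simplices S (n - 1)) (face S (n - 1))))"

text \<open>
  In the simplicial set of a Frobenius object, vertices and edges are both of the form \<open>Elt x\<close>
  (so that \<open>s\<^sub>0\<close> on vertices is an inclusion), triangles are of the form \<open>Triple x y z\<close>, and an
  \<open>n\<close>-simplex with \<open>n > 2\<close> is the list of its faces, wrapped by \<open>Fill\<close>.
\<close>

datatype 'a simplex =
    Elt (elt: 'a)
  | Triple 'a 'a 'a
  | Fill (faces: "'a simplex list")

definition cosk_face :: "'a simplex sset \<Rightarrow> nat \<Rightarrow> nat \<Rightarrow> 'a simplex \<Rightarrow> 'a simplex" where
  "cosk_face T n i x = (if n \<le> 2 then face T n i x else faces x ! i)"

fun cosk_simplices :: "'a simplex sset \<Rightarrow> nat \<Rightarrow> 'a simplex set" where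
  "cosk_simplices T n = (if n \<le> 2 then simplices T n
     else Fill ` matching_families n (cosk_simplices T (n - 1)) (cosk_face T (n - 1)))"

text \<open>
  Above dimension 2 a simplex is given by its faces, so the simplicial identities for
  \<open>d\<^sub>j s\<^sub>i\<close> dictate the degeneracies.
\<close>

fun cosk_degen :: "'a simplex sset \<Rightarrow> nat \<Rightarrow> nat \<Rightarrow> 'a simplex \<Rightarrow> 'a simplex" where
  "cosk_degen T n i x = (if n \<le> 1 then degen T n i x
     else Fill (map (\<lambda>j. if j < i then cosk_degen T (n - 1) (i - 1) (cosk_face T n j x)
                         else if j \<le> Suc i then x
                         else cosk_degen T (n - 1) i (cosk_face T n (j - 1) x))
                    [0..<Suc (Suc n)]))"

definition coskeletal_extension :: "'a simplex sset \<Rightarrow> 'a simplex sset" where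
  "coskeletal_extension T =
    \<lparr>simplices = cosk_simplices T, face = cosk_face T, degen = cosk_degen T\<rparr>"


section \<open>The simplicial set of a Frobenius object\<close>

definition frobenius_truncated :: "'a frobenius_data \<Rightarrow> 'a simplex sset" where
  "frobenius_truncated F =
    \<lparr>simplices = (\<lambda>n. if n = 0 then Elt ` Unit F
                 else if n = 1 then Elt ` Carr F
                 else if n = 2 then {Triple x y z | x y z. (x, y, z) \<in> Mult F}
                 else {}),
     face = (\<lambda>n i \<xi>. case \<xi> of
                 Elt x \<Rightarrow> Elt (if i = 0 then source F x else target F x)
               | Triple x y z \<Rightarrow> Elt (if i = 0 then y else if i = 1 then z else x)
               | Fill ys \<Rightarrow> \<xi>),
     degen = (\<lambda>n i \<xi>. if n = 0 then \<xi>
               else if i = 0 then Triple (target F (elt \<xi>)) (elt \<xi>) (elt \<xi>)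
               else Triple (elt \<xi>) (source F (elt \<xi>)) (elt \<xi>))\<rparr>"

definition frobenius_sset :: "'a frobenius_data \<Rightarrow> 'a simplex sset" where
  "frobenius_sset F = coskeletal_extension (frobenius_truncated F)"

text \<open>
  Edges are read as elements of the carrier through \<open>elt\<close>.
\<close>

definition triangle_edges :: "'a simplex sset \<Rightarrow> 'a simplex \<Rightarrow> 'a \<times> 'a \<times> 'a" where
  "triangle_edges S \<zeta> = (elt (face S 2 2 \<zeta>), elt (face S 2 0 \<zeta>), elt (face S 2 1 \<zeta>))"

definition edge_set :: "'a simplex sset \<Rightarrow> 'a set" where
  "edge_set S = elt ` simplices S 1"

definition rotation :: "'a set \<Rightarrow> ('a \<Rightarrow> 'a) \<Rightarrow> 'a \<times> 'a \<times> 'a \<Rightarrow> 'a \<times> 'a \<times> 'a" where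
  "rotation X a = (\<lambda>(x, y, z)\<in>X \<times> X \<times> X. (y, a z, a x))"


section \<open>Well-definedness\<close>

lemma frobenius_axioms:
  assumes "frobenius_object F"
  shows "Counit F \<subseteq> Carr F" "Unit F \<subseteq> Carr F"
    "Comult F \<subseteq> Carr F \<times> Carr F \<times> Carr F" "Mult F \<subseteq> Carr F \<times> Carr F \<times> Carr F"
    "(lunitor (Carr F))\<inverse> O (unit_rel F \<boxtimes> Id_on (Carr F)) O mult_rel F = Id_on (Carr F)"
    "(runitor (Carr F))\<inverse> O (Id_on (Carr F) \<boxtimes> unit_rel F) O mult_rel F = Id_on (Carr F)"
    "comult_rel F O (counit_rel F \<boxtimes> Id_on (Carr F)) O lunitor (Carr F) = Id_on (Carr F)"
    "comult_rel F O (Id_on (Carr F) \<boxtimes> counit_rel F) O runitor (Carr F) = Id_on (Carr F)"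
    "(comult_rel F \<boxtimes> Id_on (Carr F)) O associator (Carr F) O (Id_on (Carr F) \<boxtimes> mult_rel F)
       = mult_rel F O comult_rel F"
    "(Id_on (Carr F) \<boxtimes> comult_rel F) O (associator (Carr F))\<inverse> O (mult_rel F \<boxtimes> Id_on (Carr F))
       = mult_rel F O comult_rel F"
  using assms unfolding frobenius_object_def Let_def by - (elim conjE, assumption)+

lemma frobenius_in_carr:
  assumes "frobenius_object F"
  shows "(x, y, z) \<in> Mult F \<Longrightarrow> x \<in> Carr F \<and> y \<in> Carr F \<and> z \<in> Carr F"
    and "(x, y, z) \<in> Comult F \<Longrightarrow> x \<in> Carr F \<and> y \<in> Carr F \<and> z \<in> Carr F"
    and "u \<in> Unit F \<Longrightarrow> u \<in> Carr F" and "u \<in> Counit F \<Longrightarrow> u \<in> Carr F"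
  using frobenius_axioms(1-4)[OF assms] by blast+

lemma frobenius_unitD:
  assumes F: "frobenius_object F"
  shows "x \<in> Carr F \<Longrightarrow> \<exists>u\<in>Unit F. (u, x, x) \<in> Mult F"
    and "x \<in> Carr F \<Longrightarrow> \<exists>u\<in>Unit F. (x, u, x) \<in> Mult F"
    and "u \<in> Unit F \<Longrightarrow> (u, x, y) \<in> Mult F \<Longrightarrow> x = y"
    and "u \<in> Unit F \<Longrightarrow> (x, u, y) \<in> Mult F \<Longrightarrow> x = y"
proof -
  have l: "(lunitor (Carr F))\<inverse> O (unit_rel F \<boxtimes> Id_on (Carr F)) O mult_rel F
      = {(x, y). x \<in> Carr F \<and> (\<exists>u\<in>Unit F. (u, x, y) \<in> Mult F)}"
    by (auto simp: lunitor_def unit_rel_def rel_times_def mult_rel_def Id_on_def relcomp_unfold)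
  have r: "(runitor (Carr F))\<inverse> O (Id_on (Carr F) \<boxtimes> unit_rel F) O mult_rel F
      = {(x, y). x \<in> Carr F \<and> (\<exists>u\<in>Unit F. (x, u, y) \<in> Mult F)}"
    by (auto simp: runitor_def unit_rel_def rel_times_def mult_rel_def Id_on_def relcomp_unfold)
  have L: "{(x, y). x \<in> Carr F \<and> (\<exists>u\<in>Unit F. (u, x, y) \<in> Mult F)} = Id_on (Carr F)"
    and R: "{(x, y). x \<in> Carr F \<and> (\<exists>u\<in>Unit F. (x, u, y) \<in> Mult F)} = Id_on (Carr F)"
    using frobenius_axioms(5,6)[OF F] unfolding l r by this+
  have L': "x \<in> Carr F \<and> (\<exists>u\<in>Unit F. (u, x, y) \<in> Mult F) \<longleftrightarrow> x = y \<and> x \<in> Carr F" for x y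
    using arg_cong[OF L, of "\<lambda>S. (x, y) \<in> S"] by auto
  have R': "x \<in> Carr F \<and> (\<exists>u\<in>Unit F. (x, u, y) \<in> Mult F) \<longleftrightarrow> x = y \<and> x \<in> Carr F" for x y
    using arg_cong[OF R, of "\<lambda>S. (x, y) \<in> S"] by auto
  show "x \<in> Carr F \<Longrightarrow> \<exists>u\<in>Unit F. (u, x, x) \<in> Mult F" using L'[of x x] by simp
  show "x \<in> Carr F \<Longrightarrow> \<exists>u\<in>Unit F. (x, u, x) \<in> Mult F" using R'[of x x] by simp
  show "x = y" if "u \<in> Unit F" "(u, x, y) \<in> Mult F"
    using L'[where x = x and y = y] that frobenius_in_carr(1)[OF F that(2)] by blast
  show "x = y" if "u \<in> Unit F" "(x, u, y) \<in> Mult F"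
    using R'[where x = x and y = y] that frobenius_in_carr(1)[OF F that(2)] by blast
qed

lemma frobenius_counitD:
  assumes F: "frobenius_object F"
  shows "x \<in> Carr F \<Longrightarrow> \<exists>e\<in>Counit F. (x, e, x) \<in> Comult F"
    and "x \<in> Carr F \<Longrightarrow> \<exists>e\<in>Counit F. (x, x, e) \<in> Comult F"
    and "e \<in> Counit F \<Longrightarrow> (x, e, y) \<in> Comult F \<Longrightarrow> x = y"
    and "e \<in> Counit F \<Longrightarrow> (x, y, e) \<in> Comult F \<Longrightarrow> x = y"
proof -
  have l: "comult_rel F O (counit_rel F \<boxtimes> Id_on (Carr F)) O lunitor (Carr F)
      = {(x, y). y \<in> Carr F \<and> (\<exists>e\<in>Counit F. (x, e, y) \<in> Comult F)}"
    by (auto simp: lunitor_def counit_rel_def rel_times_def comult_rel_def Id_on_def relcomp_unfold)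
  have r: "comult_rel F O (Id_on (Carr F) \<boxtimes> counit_rel F) O runitor (Carr F)
      = {(x, y). y \<in> Carr F \<and> (\<exists>e\<in>Counit F. (x, y, e) \<in> Comult F)}"
    by (auto simp: runitor_def counit_rel_def rel_times_def comult_rel_def Id_on_def relcomp_unfold)
  have L: "{(x, y). y \<in> Carr F \<and> (\<exists>e\<in>Counit F. (x, e, y) \<in> Comult F)} = Id_on (Carr F)"
    and R: "{(x, y). y \<in> Carr F \<and> (\<exists>e\<in>Counit F. (x, y, e) \<in> Comult F)} = Id_on (Carr F)"
    using frobenius_axioms(7,8)[OF F] unfolding l r by this+
  have L': "y \<in> Carr F \<and> (\<exists>e\<in>Counit F. (x, e, y) \<in> Comult F) \<longleftrightarrow> x = y \<and> x \<in> Carr F" for x y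
    using arg_cong[OF L, of "\<lambda>S. (x, y) \<in> S"] by auto
  have R': "y \<in> Carr F \<and> (\<exists>e\<in>Counit F. (x, y, e) \<in> Comult F) \<longleftrightarrow> x = y \<and> x \<in> Carr F" for x y
    using arg_cong[OF R, of "\<lambda>S. (x, y) \<in> S"] by auto
  show "x \<in> Carr F \<Longrightarrow> \<exists>e\<in>Counit F. (x, e, x) \<in> Comult F" using L'[of x x] by simp
  show "x \<in> Carr F \<Longrightarrow> \<exists>e\<in>Counit F. (x, x, e) \<in> Comult F" using R'[of x x] by simp
  show "x = y" if "e \<in> Counit F" "(x, e, y) \<in> Comult F"
    using L'[where x = x and y = y] that frobenius_in_carr(2)[OF F that(2)] by blast
  show "x = y" if "e \<in> Counit F" "(x, y, e) \<in> Comult F"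
    using R'[where x = x and y = y] that frobenius_in_carr(2)[OF F that(2)] by blast
qed

lemma frobenius_law:
  assumes F: "frobenius_object F"
  shows "(\<exists>p. (a, c, p) \<in> Comult F \<and> (p, b, d) \<in> Mult F) \<longleftrightarrow>
         (\<exists>m. (a, b, m) \<in> Mult F \<and> (m, c, d) \<in> Comult F)"
    and "(\<exists>q. (b, q, d) \<in> Comult F \<and> (a, q, c) \<in> Mult F) \<longleftrightarrow>
         (\<exists>m. (a, b, m) \<in> Mult F \<and> (m, c, d) \<in> Comult F)"
proof -
  note [dest] = frobenius_in_carr(1,2)[OF F]
  let ?X = "Carr F"
  have m: "((a, b), (c, d)) \<in> mult_rel F O comult_rel F \<longleftrightarrow>
      (\<exists>m. (a, b, m) \<in> Mult F \<and> (m, c, d) \<in> Comult F)"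
    by (auto simp: mult_rel_def comult_rel_def relcomp_unfold)
  have l: "((a, b), (c, d)) \<in> (comult_rel F \<boxtimes> Id_on ?X) O associator ?X O (Id_on ?X \<boxtimes> mult_rel F)
      \<longleftrightarrow> (\<exists>p. (a, c, p) \<in> Comult F \<and> (p, b, d) \<in> Mult F)"
    by (auto simp: mult_rel_def comult_rel_def relcomp_unfold rel_times_def associator_def Id_on_def,
        (blast+)?)
  have r: "((a, b), (c, d)) \<in> (Id_on ?X \<boxtimes> comult_rel F) O (associator ?X)\<inverse> O (mult_rel F \<boxtimes> Id_on ?X)
      \<longleftrightarrow> (\<exists>q. (b, q, d) \<in> Comult F \<and> (a, q, c) \<in> Mult F)"
    by (auto simp: mult_rel_def comult_rel_def relcomp_unfold rel_times_def associator_def Id_on_def,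
        (blast+)?)
  from frobenius_axioms(9,10)[OF F] l r m show "(\<exists>p. (a, c, p) \<in> Comult F \<and> (p, b, d) \<in> Mult F) \<longleftrightarrow>
         (\<exists>m. (a, b, m) \<in> Mult F \<and> (m, c, d) \<in> Comult F)"
    and "(\<exists>q. (b, q, d) \<in> Comult F \<and> (a, q, c) \<in> Mult F) \<longleftrightarrow>
         (\<exists>m. (a, b, m) \<in> Mult F \<and> (m, c, d) \<in> Comult F)"
    by simp_all
qed

definition pairing :: "'a frobenius_data \<Rightarrow> ('a \<times> 'a) set" where
  "pairing F = {(x, y). \<exists>e\<in>Counit F. (x, y, e) \<in> Mult F}"

definition copairing :: "'a frobenius_data \<Rightarrow> ('a \<times> 'a) set" where
  "copairing F = {(x, y). \<exists>u\<in>Unit F. (u, x, y) \<in> Comult F}"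

lemma comult_iff:
  assumes F: "frobenius_object F"
  shows "(b, c, d) \<in> Comult F \<longleftrightarrow> (\<exists>p. (c, p) \<in> copairing F \<and> (p, b, d) \<in> Mult F)"
    and "(b, c, d) \<in> Comult F \<longleftrightarrow> (\<exists>q. (q, d) \<in> copairing F \<and> (b, q, c) \<in> Mult F)"
proof -
  show "(b, c, d) \<in> Comult F \<longleftrightarrow> (\<exists>p. (c, p) \<in> copairing F \<and> (p, b, d) \<in> Mult F)"
  proof
    assume "(b, c, d) \<in> Comult F"
    moreover obtain u where u: "u \<in> Unit F" "(u, b, b) \<in> Mult F"
      using frobenius_unitD(1)[OF F] frobenius_in_carr(2)[OF F calculation] by blast
    ultimately obtain p where "(u, c, p) \<in> Comult F" "(p, b, d) \<in> Mult F"
      using frobenius_law(1)[OF F] by blast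
    then show "\<exists>p. (c, p) \<in> copairing F \<and> (p, b, d) \<in> Mult F"
      using u by (auto simp: copairing_def)
  next
    assume "\<exists>p. (c, p) \<in> copairing F \<and> (p, b, d) \<in> Mult F"
    then obtain p u where "u \<in> Unit F" "(u, c, p) \<in> Comult F" "(p, b, d) \<in> Mult F"
      by (auto simp: copairing_def)
    then show "(b, c, d) \<in> Comult F"
      using frobenius_law(1)[OF F, of u c b d] frobenius_unitD(3)[OF F] by blast
  qed
  show "(b, c, d) \<in> Comult F \<longleftrightarrow> (\<exists>q. (q, d) \<in> copairing F \<and> (b, q, c) \<in> Mult F)"
  proof
    assume "(b, c, d) \<in> Comult F"
    moreover obtain u where u: "u \<in> Unit F" "(b, u, b) \<in> Mult F"
      using frobenius_unitD(2)[OF F] frobenius_in_carr(2)[OF F calculation] by blast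
    ultimately obtain q where "(u, q, d) \<in> Comult F" "(b, q, c) \<in> Mult F"
      using frobenius_law(2)[OF F] by blast
    then show "\<exists>q. (q, d) \<in> copairing F \<and> (b, q, c) \<in> Mult F"
      using u by (auto simp: copairing_def)
  next
    assume "\<exists>q. (q, d) \<in> copairing F \<and> (b, q, c) \<in> Mult F"
    then obtain q u where "u \<in> Unit F" "(u, q, d) \<in> Comult F" "(b, q, c) \<in> Mult F"
      by (auto simp: copairing_def)
    then show "(b, c, d) \<in> Comult F"
      using frobenius_law(2)[OF F, of u d b c] frobenius_unitD(4)[OF F] by blast
  qed
qed

lemma snake:
  assumes F: "frobenius_object F"
  shows "copairing F O pairing F = Id_on (Carr F)"
    and "pairing F O copairing F = Id_on (Carr F)"
proof -
  have 1: "(c, b) \<in> copairing F O pairing F \<longleftrightarrow> (\<exists>d\<in>Counit F. (b, c, d) \<in> Comult F)" for b c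
    unfolding comult_iff(1)[OF F] by (auto simp: pairing_def)
  have 2: "(\<exists>d\<in>Counit F. (b, c, d) \<in> Comult F) \<longleftrightarrow> c = b \<and> c \<in> Carr F" for b c
    using frobenius_counitD(2,4)[OF F] frobenius_in_carr(2)[OF F] by metis
  show "copairing F O pairing F = Id_on (Carr F)"
    by (intro equalityI subrelI; unfold 1 2 Id_on_iff; blast)
  have 3: "(b, d) \<in> pairing F O copairing F \<longleftrightarrow> (\<exists>c\<in>Counit F. (b, c, d) \<in> Comult F)" for b d
    unfolding comult_iff(2)[OF F] by (auto simp: pairing_def)
  have 4: "(\<exists>c\<in>Counit F. (b, c, d) \<in> Comult F) \<longleftrightarrow> b = d \<and> b \<in> Carr F" for b d
    using frobenius_counitD(1,3)[OF F] frobenius_in_carr(2)[OF F] by metis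
  show "pairing F O copairing F = Id_on (Carr F)"
    by (intro equalityI subrelI; unfold 3 4 Id_on_iff; blast)
qed

lemma copairing_props:
  assumes F: "frobenius_object F"
  shows "q \<in> Carr F \<Longrightarrow> \<exists>d. (q, d) \<in> copairing F" "d \<in> Carr F \<Longrightarrow> \<exists>q. (q, d) \<in> copairing F"
    "(q, d) \<in> copairing F \<Longrightarrow> (q', d) \<in> copairing F \<Longrightarrow> q = q'"
    "(q, d) \<in> copairing F \<Longrightarrow> (q, d') \<in> copairing F \<Longrightarrow> d = d'"
    "(q, d) \<in> copairing F \<Longrightarrow> q \<in> Carr F \<and> d \<in> Carr F"
proof -
  have s: "(\<exists>y. (x, y) \<in> copairing F \<and> (y, z) \<in> pairing F) \<longleftrightarrow> x = z \<and> x \<in> Carr F"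
    "(\<exists>y. (x, y) \<in> pairing F \<and> (y, z) \<in> copairing F) \<longleftrightarrow> x = z \<and> x \<in> Carr F" for x z
    using arg_cong[OF snake(1)[OF F], of "\<lambda>S. (x, z) \<in> S"]
      arg_cong[OF snake(2)[OF F], of "\<lambda>S. (x, z) \<in> S"]
    by (auto simp: relcomp_unfold Id_on_iff)
  have carr: "q \<in> Carr F \<and> d \<in> Carr F" if "(q, d) \<in> copairing F" for q d
    using that frobenius_in_carr(2)[OF F] by (auto simp: copairing_def)
  show "\<exists>d. (q, d) \<in> copairing F" if "q \<in> Carr F"
    using s(1)[of q q] that by auto
  show "\<exists>q. (q, d) \<in> copairing F" if "d \<in> Carr F"
    using s(2)[of d d] that by auto
  show "(q, d) \<in> copairing F \<Longrightarrow> q \<in> Carr F \<and> d \<in> Carr F"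
    by (rule carr)
  show "q = q'" if h: "(q, d) \<in> copairing F" "(q', d) \<in> copairing F"
  proof -
    obtain p where p: "(q, p) \<in> copairing F" "(p, q) \<in> pairing F"
      using s(1)[of q q] carr[OF h(1)] by auto
    have "p = d" using s(2)[of p d] p h by auto
    then have "(d, q) \<in> pairing F" using p by simp
    then show ?thesis using s(1)[of q' q] h by auto
  qed
  show "d = d'" if h: "(q, d) \<in> copairing F" "(q, d') \<in> copairing F"
  proof -
    obtain p where "(p, q) \<in> pairing F"
      using s(1)[of q q] carr[OF h(1)] by auto
    then show ?thesis using s(2)[of p d] s(2)[of p d'] h by auto
  qed
qed

lemma mult_assoc_iff:
  assumes F: "frobenius_object F"
  shows "(\<exists>m. (a, b, m) \<in> Mult F \<and> (m, q, c) \<in> Mult F) \<longleftrightarrow>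
         (\<exists>r. (b, q, r) \<in> Mult F \<and> (a, r, c) \<in> Mult F)"
proof (cases "q \<in> Carr F")
  case False
  then show ?thesis using frobenius_in_carr(1)[OF F] by blast
next
  case True
  then obtain d where d: "(q, d) \<in> copairing F" using copairing_props(1)[OF F] by blast
  have "(m, q, c) \<in> Mult F \<longleftrightarrow> (m, c, d) \<in> Comult F" for m
    unfolding comult_iff(2)[OF F] using d copairing_props(3)[OF F] by blast
  moreover have "(b, q, r) \<in> Mult F \<longleftrightarrow> (b, r, d) \<in> Comult F" for r
    unfolding comult_iff(2)[OF F] using d copairing_props(3)[OF F] by blast
  ultimately show ?thesis
    using frobenius_law(2)[OF F, of b d a c] by simp
qed

lemma alpha_hat_props:
  assumes F: "frobenius_object F"
  shows "alpha_hat F \<in> Carr F \<rightarrow>\<^sub>E Carr F"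
    and "{(x, y). ((x, y), ()) \<in> mult_rel F O counit_rel F} = {(x, alpha_hat F x) | x. x \<in> Carr F}"
    and "pairing F = {(x, alpha_hat F x) | x. x \<in> Carr F}"
    and "bij_betw (alpha_hat F) (Carr F) (Carr F)"
proof -
  let ?P = "\<lambda>f. f \<in> Carr F \<rightarrow>\<^sub>E Carr F \<and>
    {(x, y). ((x, y), ()) \<in> mult_rel F O counit_rel F} = {(x, f x) | x. x \<in> Carr F}"
  have eq: "{(x, y). ((x, y), ()) \<in> mult_rel F O counit_rel F} = pairing F"
    by (auto simp: mult_rel_def counit_rel_def pairing_def relcomp_unfold)
  have s: "(\<exists>y. (x, y) \<in> copairing F \<and> (y, z) \<in> pairing F) \<longleftrightarrow> x = z \<and> x \<in> Carr F"
    "(\<exists>y. (x, y) \<in> pairing F \<and> (y, z) \<in> copairing F) \<longleftrightarrow> x = z \<and> x \<in> Carr F" for x z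
    using arg_cong[OF snake(1)[OF F], of "\<lambda>S. (x, z) \<in> S"]
      arg_cong[OF snake(2)[OF F], of "\<lambda>S. (x, z) \<in> S"]
    by (auto simp: relcomp_unfold Id_on_iff)
  have carr: "q \<in> Carr F \<and> d \<in> Carr F" if "(q, d) \<in> pairing F" for q d
    using that frobenius_in_carr(1)[OF F] by (auto simp: pairing_def)
  have ex: "\<exists>!y. (x, y) \<in> pairing F" if x: "x \<in> Carr F" for x
  proof -
    obtain w where w: "(w, x) \<in> copairing F" using copairing_props(2)[OF F x] by blast
    have "y = w" if "(x, y) \<in> pairing F" for y using s(1)[of w y] w that by blast
    then show ?thesis using s(2)[of x x] x by blast
  qed
  have ex': "\<exists>!x. (x, y) \<in> pairing F" if y: "y \<in> Carr F" for y
  proof -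
    obtain w where w: "(y, w) \<in> copairing F" using copairing_props(1)[OF F y] by blast
    have "x = w" if "(x, y) \<in> pairing F" for x using s(2)[of x w] w that by blast
    then show ?thesis using s(1)[of y y] y by blast
  qed
  have "\<exists>!f. ?P f"
  proof (rule ex1I)
    show "?P (\<lambda>x\<in>Carr F. THE y. (x, y) \<in> pairing F)"
    proof -
      have the: "(x, THE y. (x, y) \<in> pairing F) \<in> pairing F" if "x \<in> Carr F" for x
        using theI'[OF ex[OF that]] .
      moreover have "y = (THE y. (x, y) \<in> pairing F)" if "(x, y) \<in> pairing F" for x y
        using ex the carr that by blast
      moreover have "(THE y. (x, y) \<in> pairing F) \<in> Carr F" if "x \<in> Carr F" for x
        using carr[OF the[OF that]] by simp
      ultimately show ?thesis
        unfolding eq using carr by (auto 0 3)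
    qed
  next
    fix f assume f: "?P f"
    then have "(x, f x) \<in> pairing F" if "x \<in> Carr F" for x
      unfolding eq using that by blast
    then have "f x = (THE y. (x, y) \<in> pairing F)" if "x \<in> Carr F" for x
      using the1_equality[OF ex[OF that]] that by metis
    then show "f = (\<lambda>x\<in>Carr F. THE y. (x, y) \<in> pairing F)"
      using f by (intro ext) (auto simp: PiE_def extensional_def)
  qed
  then have P: "?P (alpha_hat F)"
    unfolding alpha_hat_def by (rule theI')
  then show "alpha_hat F \<in> Carr F \<rightarrow>\<^sub>E Carr F"
    and "{(x, y). ((x, y), ()) \<in> mult_rel F O counit_rel F} = {(x, alpha_hat F x) | x. x \<in> Carr F}"
    by auto
  then show g: "pairing F = {(x, alpha_hat F x) | x. x \<in> Carr F}"
    unfolding eq by simp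
  show "bij_betw (alpha_hat F) (Carr F) (Carr F)"
    unfolding bij_betw_def
  proof
    show "inj_on (alpha_hat F) (Carr F)"
      using ex' g P by (intro inj_onI) (metis (mono_tags, lifting) PiE_mem mem_Collect_eq)
    show "alpha_hat F ` Carr F = Carr F"
    proof
      show "alpha_hat F ` Carr F \<subseteq> Carr F" using P by auto
      show "Carr F \<subseteq> alpha_hat F ` Carr F" using ex' g by fast
    qed
  qed
qed

lemma source_props:
  assumes F: "frobenius_object F" and x: "x \<in> Carr F"
  shows "source F x \<in> Unit F" "(x, source F x, x) \<in> Mult F"
    "u \<in> Unit F \<Longrightarrow> (x, u, x) \<in> Mult F \<Longrightarrow> u = source F x"
proof -
  have "u = v" if "u \<in> Unit F" "(x, u, x) \<in> Mult F" "v \<in> Unit F" "(x, v, x) \<in> Mult F" for u v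
    using mult_assoc_iff[OF F, of x u v x] frobenius_unitD(3,4)[OF F] that by blast
  then have 1: "\<exists>!u. u \<in> Unit F \<and> (x, u, x) \<in> Mult F"
    using frobenius_unitD(2)[OF F x] by blast
  show "source F x \<in> Unit F" "(x, source F x, x) \<in> Mult F"
    using theI'[OF 1] unfolding source_def by auto
  show "u \<in> Unit F \<Longrightarrow> (x, u, x) \<in> Mult F \<Longrightarrow> u = source F x"
    using 1 unfolding source_def by (simp add: the1_equality)
qed

lemma target_props:
  assumes F: "frobenius_object F" and x: "x \<in> Carr F"
  shows "target F x \<in> Unit F" "(target F x, x, x) \<in> Mult F"
    "u \<in> Unit F \<Longrightarrow> (u, x, x) \<in> Mult F \<Longrightarrow> u = target F x"
proof -
  have "u = v" if "u \<in> Unit F" "(u, x, x) \<in> Mult F" "v \<in> Unit F" "(v, x, x) \<in> Mult F" for u v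
    using mult_assoc_iff[OF F, of u v x x] frobenius_unitD(3,4)[OF F] that by blast
  then have 1: "\<exists>!u. u \<in> Unit F \<and> (u, x, x) \<in> Mult F"
    using frobenius_unitD(1)[OF F x] by blast
  show "target F x \<in> Unit F" "(target F x, x, x) \<in> Mult F"
    using theI'[OF 1] unfolding target_def by auto
  show "u \<in> Unit F \<Longrightarrow> (u, x, x) \<in> Mult F \<Longrightarrow> u = target F x"
    using 1 unfolding target_def by (simp add: the1_equality)
qed

lemma source_target_mult:
  assumes F: "frobenius_object F" and m: "(x, y, z) \<in> Mult F"
  shows "source F y = source F z" "target F x = target F z" "source F x = target F y"
proof -
  note c = frobenius_in_carr(1)[OF F m]
  note sp = source_props[OF F] and tp = target_props[OF F]
  obtain w where "(y, source F z, w) \<in> Mult F"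
    using mult_assoc_iff[OF F, of x y "source F z" z] m sp(2) c by blast
  then show "source F y = source F z"
    using sp(1,3) c frobenius_unitD(4)[OF F] by metis
  obtain w where "(target F z, x, w) \<in> Mult F"
    using mult_assoc_iff[OF F, of "target F z" x y z] m tp(2) c by blast
  then show "target F x = target F z"
    using tp(1,3) c frobenius_unitD(3)[OF F] by metis
  obtain w where "(source F x, y, w) \<in> Mult F"
    using mult_assoc_iff[OF F, of x "source F x" y z] m sp(2) c by blast
  then show "source F x = target F y"
    using sp(1) tp(3) c frobenius_unitD(3)[OF F] by metis
qed

lemma source_target_unit:
  assumes F: "frobenius_object F" and u: "u \<in> Unit F"
  shows "source F u = u" "target F u = u"
proof -
  have uc: "u \<in> Carr F" using frobenius_in_carr(3)[OF F u] .
  obtain v where "v \<in> Unit F" "(v, u, u) \<in> Mult F" using frobenius_unitD(1)[OF F uc] by blast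
  moreover have "v = u" using calculation frobenius_unitD(4)[OF F u] by blast
  ultimately have "(u, u, u) \<in> Mult F" by simp
  then show "source F u = u" "target F u = u"
    using source_props(3)[OF F uc u] target_props(3)[OF F uc u] by auto
qed

lemma frobenius_truncated_simplicial:
  assumes F: "frobenius_object F"
  shows "truncated_simplicial_set 2 (frobenius_truncated F)"
proof -
  note c = frobenius_in_carr(1,3)[OF F] and sp = source_props[OF F] and tp = target_props[OF F]
    and st = source_target_mult[OF F] and su = source_target_unit[OF F]
  have n2: "n < (2::nat) \<longleftrightarrow> n = 0 \<or> n = 1" "Suc n < 2 \<longleftrightarrow> n = 0" for n by auto
  have i2: "i \<le> Suc 0 \<longleftrightarrow> i = 0 \<or> i = 1" "i \<le> Suc (Suc 0) \<longleftrightarrow> i = 0 \<or> i = 1 \<or> i = 2" for i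
    by auto
  show ?thesis
    unfolding truncated_simplicial_set_def
  proof (intro conjI allI impI)
    fix n i :: nat assume "n < 2 \<and> i \<le> Suc n"
    then show "face (frobenius_truncated F) (Suc n) i
        \<in> simplices (frobenius_truncated F) (Suc n) \<rightarrow> simplices (frobenius_truncated F) n"
      by (auto simp: n2 i2 frobenius_truncated_def sp tp dest: c)
  next
    fix n i :: nat assume "n < 2 \<and> i \<le> n"
    then show "degen (frobenius_truncated F) n i
        \<in> simplices (frobenius_truncated F) n \<rightarrow> simplices (frobenius_truncated F) (Suc n)"
      by (auto simp: n2 i2 frobenius_truncated_def sp tp dest: c)
  next
    fix n i j :: nat and x
    assume "Suc n < 2 \<and> i < j \<and> j \<le> Suc (Suc n) \<and> x \<in> simplices (frobenius_truncated F) (Suc (Suc n))"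
    then show "face (frobenius_truncated F) (Suc n) i (face (frobenius_truncated F) (Suc (Suc n)) j x)
        = face (frobenius_truncated F) (Suc n) (j - 1) (face (frobenius_truncated F) (Suc (Suc n)) i x)"
      by (auto simp: n2 i2 frobenius_truncated_def st)
  next
    fix n i j :: nat and x
    assume "Suc n < 2 \<and> i \<le> j \<and> j \<le> n \<and> x \<in> simplices (frobenius_truncated F) n"
    then show "degen (frobenius_truncated F) (Suc n) i (degen (frobenius_truncated F) n j x)
        = degen (frobenius_truncated F) (Suc n) (Suc j) (degen (frobenius_truncated F) n i x)"
      by (auto simp: n2 i2 frobenius_truncated_def su)
  next
    fix n i j :: nat and x
    assume "n < 2 \<and> i \<le> Suc n \<and> j \<le> n \<and> x \<in> simplices (frobenius_truncated F) n"
    then show "face (frobenius_truncated F) (Suc n) i (degen (frobenius_truncated F) n j x) =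
        (if i < j then degen (frobenius_truncated F) (n - 1) (j - 1) (face (frobenius_truncated F) n i x)
         else if i \<le> Suc j then x
         else degen (frobenius_truncated F) (n - 1) j (face (frobenius_truncated F) n (i - 1) x))"
      by (auto simp: n2 i2 frobenius_truncated_def su)
  qed
qed

declare cosk_simplices.simps [simp del] cosk_degen.simps [simp del]

lemma matching_familiesD:
  assumes "ys \<in> matching_families (Suc n) A d"
  shows "i \<le> Suc n \<Longrightarrow> ys ! i \<in> A"
    and "i \<le> j \<Longrightarrow> j \<le> n \<Longrightarrow> d i (ys ! Suc j) = d j (ys ! i)"
    and "length ys = Suc (Suc n)"
proof -
  have l: "length ys = Suc (Suc n)" and A: "set ys \<subseteq> A"
    and m: "\<forall>i j. i < j \<and> j \<le> Suc n \<longrightarrow> d i (ys ! j) = d (j - 1) (ys ! i)"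
    using assms unfolding matching_families_def mem_Collect_eq by - (elim conjE, assumption)+
  show "ys ! i \<in> A" if "i \<le> Suc n"
  proof -
    have "i < length ys" unfolding l using that by linarith
    then show ?thesis using A nth_mem by blast
  qed
  show "d i (ys ! Suc j) = d j (ys ! i)" if "i \<le> j" "j \<le> n"
  proof -
    have "i < Suc j \<and> Suc j \<le> Suc n" using that by linarith
    then have "d i (ys ! Suc j) = d (Suc j - 1) (ys ! i)" using m by blast
    then show ?thesis by (simp only: diff_Suc_1)
  qed
  show "length ys = Suc (Suc n)" by (rule l)
qed

lemma coskeletal_extension_simplicial:
  assumes T: "truncated_simplicial_set 2 T"
  shows "simplicial_set (coskeletal_extension T)"
    and "coskeletal2 (coskeletal_extension T)"
proof -
  define X d s where "X = cosk_simplices T" and "d = cosk_face T" and "s = cosk_degen T"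
  have sel [simp]: "simplices (coskeletal_extension T) = X" "face (coskeletal_extension T) = d"
    "degen (coskeletal_extension T) = s"
    by (simp_all add: coskeletal_extension_def X_def d_def s_def)
  have lowX: "X n = simplices T n" and lowd: "d n = face T n" if "n \<le> 2" for n
    using that by (simp_all add: X_def d_def cosk_face_def cosk_simplices.simps fun_eq_iff)
  have lows: "s n = degen T n" if "n \<le> 1" for n
    using that by (intro ext) (simp add: s_def cosk_degen.simps)
  have highX: "X (Suc n) = Fill ` matching_families (Suc n) (X n) (d n)" if "2 \<le> n" for n
    using that by (simp add: X_def d_def cosk_simplices.simps[of T "Suc n"])
  have highd: "d (Suc n) i (Fill ys) = ys ! i" if "2 \<le> n" for n i ys
    using that by (simp add: d_def cosk_face_def)
  have highs: "s n j x = Fill (map (\<lambda>i. if i < j then s (n - 1) (j - 1) (d n i x)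
                  else if i \<le> Suc j then x else s (n - 1) j (d n (i - 1) x)) [0..<Suc (Suc n)])"
    if "2 \<le> n" for n j x
    using that unfolding s_def d_def by (subst cosk_degen.simps) (simp del: upt_Suc)
  note T' = T[unfolded truncated_simplicial_set_def]

  have A: "d (Suc n) i x \<in> X n" if "i \<le> Suc n" "x \<in> X (Suc n)" for n i x
  proof (cases "n < 2")
    case True
    then show ?thesis using T' that by (auto simp: lowX lowd Pi_iff)
  next
    case False
    then show ?thesis using that matching_familiesD(1) by (fastforce simp: highX highd)
  qed
  have B: "d (Suc n) i (d (Suc (Suc n)) (Suc j) x) = d (Suc n) j (d (Suc (Suc n)) i x)"
    if "i \<le> j" "j \<le> Suc n" "x \<in> X (Suc (Suc n))" for n i j x
  proof (cases "n = 0")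
    case True
    then show ?thesis
      using T' that by (auto simp: lowX lowd dest!: spec[of _ i] spec[of _ "Suc j"])
  next
    case False
    then have "2 \<le> Suc n" by simp
    then show ?thesis using that by (auto simp: highX highd dest: matching_familiesD(2))
  qed
  have D: "d (Suc n) i (s n j x) = (if i < j then s (n - 1) (j - 1) (d n i x)
                  else if i \<le> Suc j then x else s (n - 1) j (d n (i - 1) x))"
    if "i \<le> Suc n" "j \<le> n" "x \<in> X n" for n i j x
  proof (cases "n < 2")
    case True
    then have "s (n - 1) = degen T (n - 1)" by (intro lows) simp
    then show ?thesis using T' that True by (auto simp: lowX lowd lows)
  next
    case False
    then show ?thesis
      using that by (subst highs) (simp_all add: highd del: upt_Suc)
  qed
  have D1: "d (Suc (Suc n)) i (s (Suc n) (Suc j) x) = s n j (d (Suc n) i x)"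
    if "i \<le> j" "j \<le> n" "x \<in> X (Suc n)" for n i j x
    using that D[of i "Suc n" "Suc j" x] by simp
  have D2: "d (Suc n) i (s n j x) = x" if "i = j \<or> i = Suc j" "j \<le> n" "x \<in> X n" for n i j x
    using that D[of i n j x] by auto
  have D3: "d (Suc (Suc n)) (Suc i) (s (Suc n) j x) = s n j (d (Suc n) i x)"
    if "j < i" "i \<le> Suc n" "x \<in> X (Suc n)" for n i j x
    using that D[of "Suc i" "Suc n" j x] by simp

  have C: "s n j x \<in> X (Suc n)" if "j \<le> n" "x \<in> X n" for n j x
    using that
  proof (induction n arbitrary: j x)
    case 0
    then show ?case using T' by (auto simp: lowX lows Pi_iff)
  next
    case (Suc m)
    show ?case
    proof (cases "m = 0")
      case True
      then show ?thesis using T' Suc.prems by (auto simp: lowX lows Pi_iff)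
    next
      case False
      then obtain p where p: "m = Suc p" using not0_implies_Suc by blast
      note x = Suc.prems(2)
      define f where "f i = (if i < j then s m (j - 1) (d (Suc m) i x)
                  else if i \<le> Suc j then x else s m j (d (Suc m) (i - 1) x))" for i
      have f1: "f i = s m j' (d (Suc m) i x)" if "j = Suc j'" "i \<le> j'" for i j'
        using that by (simp add: f_def)
      have f2: "f i = x" if "i = j \<or> i = Suc j" for i
        using that by (auto simp: f_def)
      have f3: "f (Suc i) = s m j (d (Suc m) i x)" if "j < i" for i
        using that by (simp add: f_def)
      have sx: "s (Suc m) j x = Fill (map f [0..<Suc (Suc (Suc m))])"
        using False by (subst highs) (simp_all add: f_def del: upt_Suc)
      have fX: "f i \<in> X (Suc m)" if "i \<le> Suc (Suc m)" for i
        using that Suc.prems Suc.IH A[OF _ x] by (auto simp: f_def)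
      have "d (Suc m) a (f (Suc b)) = d (Suc m) b (f a)" if ab: "a \<le> b" "b \<le> Suc m" for a b
      proof -
        consider "Suc b < j" | "Suc b = j \<or> b = j" "a < j" | "a = j" "b = j" | "j < b" "a < j"
          | "j < b" "a = j \<or> a = Suc j" | "j < b" "Suc j < a"
          using ab by linarith
        then show ?thesis
        proof cases
          case 1
          obtain j' where j: "j = Suc (Suc j')" using 1 that[of "j - 2"] by auto
          then have "f (Suc b) = s m (Suc j') (d (Suc m) (Suc b) x)"
            "f a = s m (Suc j') (d (Suc m) a x)"
            using f1[of "Suc j'"] 1 ab by auto
          then show ?thesis
            using D1[of a j' p "d (Suc m) (Suc b) x"] D1[of b j' p "d (Suc m) a x"] B[of a b p x]
              j p 1 ab x Suc.prems A by simp
        next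
          case 2
          obtain j' where j: "j = Suc j'" using 2 that[of "j - 1"] by auto
          then show ?thesis
            using f1[of j' a] f2[of "Suc b"] D2[of b j' m "d (Suc m) a x"] 2 ab x Suc.prems A
            by auto
        next
          case 3
          then show ?thesis using f2 by simp
        next
          case 4
          obtain j' b' where j: "j = Suc j'" "b = Suc b'" using 4 that[of "j - 1" "b - 1"] by auto
          then show ?thesis
            using f1[of j' a] f3[of b] D1[of a j' p "d (Suc m) b x"] D3[of j' b' p "d (Suc m) a x"]
              B[of a b' p x] 4 ab x Suc.prems A p by auto
        next
          case 5
          then show ?thesis
            using f2[of a] f3[of b] D2[of a j m "d (Suc m) b x"] ab x Suc.prems A by auto
        next
          case 6
          obtain a' b' where j: "a = Suc a'" "b = Suc b'" using 6 that[of "a - 1" "b - 1"] by auto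
          then show ?thesis
            using f3[of a'] f3[of b] D3[of j a' p "d (Suc m) b x"] D3[of j b' p "d (Suc m) a' x"]
              B[of a' b' p x] 6 ab x Suc.prems A p by auto
        qed
      qed
      then have match: "d (Suc m) a (f b) = d (Suc m) (b - 1) (f a)" if "a < b" "b \<le> Suc (Suc m)" for a b
        using that by (cases b) auto
      have "map f [0..<Suc (Suc (Suc m))] \<in> matching_families (Suc (Suc m)) (X (Suc m)) (d (Suc m))"
        using fX match unfolding matching_families_def by (auto simp del: upt_Suc)
      then show ?thesis
        using False unfolding sx by (subst highX) auto
    qed
  qed

  have ext: "x = y" if h: "2 \<le> n" "x \<in> X (Suc n)" "y \<in> X (Suc n)"
    "\<And>i. i \<le> Suc n \<Longrightarrow> d (Suc n) i x = d (Suc n) i y" for n x y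
  proof -
    obtain xs ys where xs: "x = Fill xs" "xs \<in> matching_families (Suc n) (X n) (d n)"
      and ys: "y = Fill ys" "ys \<in> matching_families (Suc n) (X n) (d n)"
      using h(2,3) unfolding highX[OF h(1)] by blast
    have "xs = ys"
      using h(4) matching_familiesD(3)[OF xs(2)] matching_familiesD(3)[OF ys(2)]
      by (intro nth_equalityI) (auto simp: xs(1) ys(1) highd[OF h(1)])
    then show ?thesis using xs ys by simp
  qed

  have E: "s (Suc n) i (s n j x) = s (Suc n) (Suc j) (s n i x)"
    if "i \<le> j" "j \<le> n" "x \<in> X n" for n i j x
    using that
  proof (induction n arbitrary: i j x)
    case 0
    then show ?case using T' by (auto simp: lowX lows)
  next
    case (Suc m)
    note x = Suc.prems(3)
    let ?n = "Suc m"
    have sj: "s ?n j x \<in> X (Suc ?n)" and si: "s ?n i x \<in> X (Suc ?n)"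
      using C Suc.prems by simp_all
    show ?case
    proof (rule ext[of "Suc ?n"])
      show "2 \<le> Suc ?n" by simp
      show "s (Suc ?n) i (s ?n j x) \<in> X (Suc (Suc ?n))"
        "s (Suc ?n) (Suc j) (s ?n i x) \<in> X (Suc (Suc ?n))"
        using C sj si Suc.prems by simp_all
      fix k assume k: "k \<le> Suc (Suc ?n)"
      consider "k < i" | "k = i" | "k = Suc i" "i < j" | "k = Suc i" "i = j" | "Suc i < k" "k \<le> j"
        | "Suc i < k" "k = Suc j \<or> k = Suc (Suc j)" | "Suc (Suc j) < k"
        using Suc.prems by linarith
      then show "d (Suc (Suc ?n)) k (s (Suc ?n) i (s ?n j x))
          = d (Suc (Suc ?n)) k (s (Suc ?n) (Suc j) (s ?n i x))"
      proof cases
        case 1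
        obtain i' j' where ij: "i = Suc i'" "j = Suc j'"
          using 1 Suc.prems that[of "i - 1" "j - 1"] by auto
        then show ?thesis
          using D1[of k i' ?n "s ?n j x"] D1[of k j' m x] D1[of k j ?n "s ?n i x"] D1[of k i' m x]
            Suc.IH[of i' j' "d ?n k x"] 1 Suc.prems A sj si by simp
      next
        case 2
        then show ?thesis
          using D2[of k i "Suc ?n" "s ?n j x"] D1[of k j ?n "s ?n i x"] D2[of k i ?n x]
            Suc.prems sj si by simp
      next
        case 3
        then show ?thesis
          using D2[of k i "Suc ?n" "s ?n j x"] D1[of k j ?n "s ?n i x"] D2[of k i ?n x]
            Suc.prems sj si by simp
      next
        case 4
        then show ?thesis
          using D2[of k i "Suc ?n" "s ?n j x"] D2[of k "Suc j" "Suc ?n" "s ?n i x"]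
            Suc.prems sj si by simp
      next
        case 5
        obtain k' j' where kj: "k = Suc k'" "j = Suc j'"
          using 5 that[of "k - 1" "j - 1"] by auto
        then show ?thesis
          using D3[of i k' ?n "s ?n j x"] D1[of k' j' m x] D1[of k j ?n "s ?n i x"] D3[of i k' m x]
            Suc.IH[of i j' "d ?n k' x"] 5 Suc.prems A sj si by simp
      next
        case 6
        obtain k' where kj: "k = Suc k'" using 6 that[of "k - 1"] by auto
        then show ?thesis
          using D3[of i k' ?n "s ?n j x"] D2[of k' j ?n x] D2[of k "Suc j" "Suc ?n" "s ?n i x"]
            6 k Suc.prems sj si by auto
      next
        case 7
        obtain k' where kj: "k = Suc (Suc k')" using 7 that[of "k - 2"] by auto
        then show ?thesis
          using D3[of i "Suc k'" ?n "s ?n j x"] D3[of j k' m x] D3[of "Suc j" "Suc k'" ?n "s ?n i x"]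
            D3[of i k' m x] Suc.IH[of i j "d ?n k' x"] 7 k Suc.prems A sj si by simp
      qed
    qed
  qed

  show simpl: "simplicial_set (coskeletal_extension T)"
    unfolding simplicial_set_def truncated_simplicial_set_def sel
  proof (intro allI conjI impI)
    fix k n i j x assume "Suc n < k \<and> i < j \<and> j \<le> Suc (Suc n) \<and> x \<in> X (Suc (Suc n))"
    then show "d (Suc n) i (d (Suc (Suc n)) j x) = d (Suc n) (j - 1) (d (Suc (Suc n)) i x)"
      by (cases j) (auto intro: B)
  qed (use A C D E in auto)
  show "coskeletal2 (coskeletal_extension T)"
    unfolding coskeletal2_def sel
  proof (intro conjI allI impI simpl)
    fix n :: nat assume "2 < n"
    then obtain m where m: "n = Suc m" "2 \<le> m" by (cases n) auto
    have "map (\<lambda>i. d n i (Fill ys)) [0..<Suc n] = ys" if ys: "ys \<in> matching_families n (X m) (d m)" for ys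
    proof -
      have "length ys = Suc n" using matching_familiesD(3) ys m(1) by blast
      then show ?thesis
        using m by (intro nth_equalityI) (auto simp: highd simp del: upt_Suc)
    qed
    then show "bij_betw (\<lambda>x. map (\<lambda>i. d n i x) [0..<Suc n]) (X n)
        (matching_families n (X (n - 1)) (d (n - 1)))"
      using m by (intro bij_betw_byWitness[where f' = Fill]) (auto simp: highX simp del: upt_Suc)
  qed
qed

lemma frobenius_sset_coskeletal:
  "frobenius_object F \<Longrightarrow> coskeletal2 (frobenius_sset F)"
  unfolding frobenius_sset_def
  by (intro coskeletal_extension_simplicial(2) frobenius_truncated_simplicial)

lemma frobenius_sset_low:
  "simplices (frobenius_sset F) 0 = Elt ` Unit F"
  "simplices (frobenius_sset F) 1 = Elt ` Carr F"
  "simplices (frobenius_sset F) 2 = {Triple x y z | x y z. (x, y, z) \<in> Mult F}"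
  by (simp_all add: frobenius_sset_def coskeletal_extension_def cosk_simplices.simps
      frobenius_truncated_def)

lemma edge_set_frobenius: "edge_set (frobenius_sset F) = Carr F"
  unfolding edge_set_def frobenius_sset_low by (auto simp: image_iff)

lemma triangle_edges_frobenius:
  "triangle_edges (frobenius_sset F) ` simplices (frobenius_sset F) 2 = Mult F"
proof -
  have "triangle_edges (frobenius_sset F) (Triple x y z) = (x, y, z)" for x y z
    by (simp add: triangle_edges_def frobenius_sset_def coskeletal_extension_def cosk_face_def
        frobenius_truncated_def)
  then show ?thesis
    unfolding frobenius_sset_low by (force simp: image_iff)
qed

lemma rotation_Bij:
  assumes "bij_betw a X X"
  shows "rotation X a \<in> Bij (X \<times> X \<times> X)"
proof -
  let ?g = "\<lambda>(x, y, z). (inv_into X a z, x, inv_into X a y)"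
  have inv: "inv_into X a x \<in> X" "a x \<in> X" "a (inv_into X a x) = x" "inv_into X a (a x) = x"
    if "x \<in> X" for x
    using assms that bij_betw_inv_into_left[OF assms] bij_betw_inv_into_right[OF assms]
    by (auto simp: bij_betw_def inv_into_into)
  have "bij_betw (rotation X a) (X \<times> X \<times> X) (X \<times> X \<times> X)"
    by (rule bij_betw_byWitness[where f' = ?g]) (auto simp: rotation_def inv)
  then show ?thesis by (simp add: Bij_def rotation_def)
qed

lemma rotation_action:
  assumes "frobenius_object F"
  shows "group_action integer_group (Carr F \<times> Carr F \<times> Carr F)
    (\<lambda>n::int. rotation (Carr F) (alpha_hat F) [^]\<^bsub>BijGroup (Carr F \<times> Carr F \<times> Carr F)\<^esub> n)"
proof -
  let ?G = "BijGroup (Carr F \<times> Carr F \<times> Carr F)"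
  interpret G: group ?G by (rule group_BijGroup)
  have "rotation (Carr F) (alpha_hat F) \<in> carrier ?G"
    using rotation_Bij[OF alpha_hat_props(4)[OF assms]] by (simp add: BijGroup_def)
  then show ?thesis
    using G.hom_integer_group_pow
    by (intro group_action.intro group_hom.intro group_hom_axioms.intro) (auto intro: G.group_axioms)
qed

end

theory Submission
  imports Defs
begin

text \<open>
  Writing \<open>\<epsilon>(x \<cdot> y)\<close> for \<open>y = \<alpha> x\<close>, injectivity of \<open>\<alpha>\<close> lets \<open>(x, y, z) \<in> \<mu>\<close> be expressed as
  \<open>\<epsilon>((x \<cdot> y) \<cdot> \<alpha> z)\<close>. Reassociating gives \<open>\<epsilon>(x \<cdot> (y \<cdot> \<alpha> z))\<close>, which says that
  \<open>(y, \<alpha> z, \<alpha> x) \<in> \<mu>\<close>.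
\<close>

lemma mult_rotate_iff:
  assumes F: "frobenius_object F" and x: "x \<in> Carr F" and z: "z \<in> Carr F"
  shows "(x, y, z) \<in> Mult F \<longleftrightarrow> (y, alpha_hat F z, alpha_hat F x) \<in> Mult F"
proof -
  let ?\<alpha> = "alpha_hat F"
  have pairing: "(p, q) \<in> pairing F \<longleftrightarrow> p \<in> Carr F \<and> q = ?\<alpha> p" for p q
    unfolding alpha_hat_props(3)[OF F] by blast
  have inj: "inj_on ?\<alpha> (Carr F)"
    using alpha_hat_props(4)[OF F] by (rule bij_betw_imp_inj_on)
  \<comment> \<open>\<open>Mult F\<close> is a relation, so a product may be empty or have several
    values: the intermediate value \<open>m\<close> stays existentially quantified. Only
    \<open>m = z\<close> pairs with \<open>?\<alpha> z\<close>, because \<open>?\<alpha>\<close> is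
    injective.\<close>
  have "(x, y, z) \<in> Mult F \<longleftrightarrow> (\<exists>m. (x, y, m) \<in> Mult F \<and> (m, ?\<alpha> z) \<in> pairing F)"
  proof
    assume "(x, y, z) \<in> Mult F"
    then show "\<exists>m. (x, y, m) \<in> Mult F \<and> (m, ?\<alpha> z) \<in> pairing F"
      using z pairing by blast
  next
    assume "\<exists>m. (x, y, m) \<in> Mult F \<and> (m, ?\<alpha> z) \<in> pairing F"
    then obtain m where m: "(x, y, m) \<in> Mult F" "m \<in> Carr F" "?\<alpha> m = ?\<alpha> z"
      unfolding pairing by (elim exE conjE) simp
    then have "m = z"
      using inj_onD[OF inj m(3)] z by blast
    then show "(x, y, z) \<in> Mult F"
      using m(1) by simp
  qed
  also have "\<dots> \<longleftrightarrow> (\<exists>e\<in>Counit F. \<exists>m. (x, y, m) \<in> Mult F \<and> (m, ?\<alpha> z, e) \<in> Mult F)"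
    by (auto simp: pairing_def)
  also have "\<dots> \<longleftrightarrow> (\<exists>e\<in>Counit F. \<exists>r. (y, ?\<alpha> z, r) \<in> Mult F \<and> (x, r, e) \<in> Mult F)"
    by (simp only: mult_assoc_iff[OF F])
  also have "\<dots> \<longleftrightarrow> (\<exists>r. (y, ?\<alpha> z, r) \<in> Mult F \<and> (x, r) \<in> pairing F)"
    by (auto simp: pairing_def)
  \<comment> \<open>The pairing is the graph of \<open>?\<alpha>\<close>, so \<open>r\<close> is
    forced to be \<open>?\<alpha> x\<close>.\<close>
  also have "\<dots> \<longleftrightarrow> (y, ?\<alpha> z, ?\<alpha> x) \<in> Mult F"
    using x by (simp add: pairing)
  finally show ?thesis .
qed

text \<open>The rotation both preserves and reflects membership in \<open>Mult F\<close>. Equality,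
  rather than mere inclusion, is what passes to inverse powers when the carrier is infinite.\<close>

lemma rotation_image_Mult:
  assumes F: "frobenius_object F"
  shows "rotation (Carr F) (alpha_hat F) ` Mult F = Mult F"
proof (intro equalityI subsetI)
  let ?X = "Carr F" and ?\<rho> = "rotation (Carr F) (alpha_hat F)"
  have iff: "?\<rho> t \<in> Mult F \<longleftrightarrow> t \<in> Mult F" if t: "t \<in> ?X \<times> ?X \<times> ?X" for t
  proof -
    obtain x y z where xyz: "t = (x, y, z)" "x \<in> ?X" "y \<in> ?X" "z \<in> ?X"
      using t by blast
    show ?thesis
      using mult_rotate_iff[OF F xyz(2,4), of y] xyz by (simp add: rotation_def)
  qed
  note sub = subsetD[OF frobenius_axioms(4)[OF F]]
  {
    fix t assume "t \<in> ?\<rho> ` Mult F"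
    then obtain s where "t = ?\<rho> s" "s \<in> Mult F"
      by (rule imageE)
    then show "t \<in> Mult F"
      using iff[OF sub] by simp
  next
    fix t assume t: "t \<in> Mult F"
    \<comment> \<open>Bijectivity of the rotation on all triples supplies a preimage of
      \<open>t\<close>; reflection then places it in \<open>Mult F\<close>.\<close>
    have "?\<rho> ` (?X \<times> ?X \<times> ?X) = ?X \<times> ?X \<times> ?X"
      using rotation_Bij[OF alpha_hat_props(4)[OF F]] by (simp add: Bij_def bij_betw_def)
    with sub[OF t] obtain s where s: "t = ?\<rho> s" "s \<in> ?X \<times> ?X \<times> ?X"
      by (metis (no_types) imageE)
    then have "s \<in> Mult F"
      using iff[OF s(2)] t by simp
    then show "t \<in> ?\<rho> ` Mult F"
      using s(1) by (rule rev_image_eqI)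
  }
qed

text \<open>Reduces invariance under the whole integer action to invariance under its generator,
  since a subgroup is closed under negative powers too.\<close>

lemma subgroup_setwise_stabilizer:
  assumes A: "A \<subseteq> S"
  shows "subgroup {g \<in> Bij S. g ` A = A} (BijGroup S)"
proof -
  interpret group "BijGroup S" by (rule group_BijGroup)
  show ?thesis
  proof (rule subgroupI)
    show "{g \<in> Bij S. g ` A = A} \<subseteq> carrier (BijGroup S)"
      by (auto simp: BijGroup_def)
    show "{g \<in> Bij S. g ` A = A} \<noteq> {}"
    proof -
      have "(\<lambda>x\<in>S. x) ` A = A"
        using A by (simp add: restrict_def subset_iff cong: image_cong)
      then show ?thesis
        using id_Bij[of S] by blast
    qed
  next
    fix g assume g: "g \<in> {g \<in> Bij S. g ` A = A}"
    have "inv_into S g ` A = A"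
      using g A inv_into_image_cancel[of g S A] by (auto simp: Bij_def bij_betw_def)
    \<comment> \<open>Inverses in \<open>BijGroup S\<close> are extensional on \<open>S\<close>;
      restricting changes nothing on \<open>A\<close>, which lies inside \<open>S\<close>.\<close>
    then have "restrict (inv_into S g) S ` A = A"
      using A by (metis image_cong restrict_apply' subsetD)
    then show "inv\<^bsub>BijGroup S\<^esub> g \<in> {g \<in> Bij S. g ` A = A}"
      using g by (simp add: inv_BijGroup restrict_inv_into_Bij)
  next
    fix g h assume g: "g \<in> {g \<in> Bij S. g ` A = A}" and h: "h \<in> {g \<in> Bij S. g ` A = A}"
    have "compose S g h ` A = g ` h ` A"
      unfolding image_image using A by (intro image_cong) (simp_all add: compose_def subsetD)
    then show "g \<otimes>\<^bsub>BijGroup S\<^esub> h \<in> {g \<in> Bij S. g ` A = A}"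
      using g h by (simp add: BijGroup_def compose_Bij)
  qed
qed

theorem proposition5p4:
  fixes F :: "'a frobenius_data" and \<X> :: "'a simplex sset" and E :: "'a set"
  assumes "frobenius_object F"
  defines "\<X> \<equiv> frobenius_sset F"
  defines "E \<equiv> edge_set \<X>"
  shows "\<forall>n::int. (rotation E (alpha_hat F) [^]\<^bsub>BijGroup (E \<times> E \<times> E)\<^esub> n)
           ` (triangle_edges \<X> ` simplices \<X> 2) = triangle_edges \<X> ` simplices \<X> 2"
proof
  fix n :: int
  let ?S = "Carr F \<times> Carr F \<times> Carr F" and ?\<rho> = "rotation (Carr F) (alpha_hat F)"
  let ?H = "{g \<in> Bij ?S. g ` Mult F = Mult F}"
  have "?\<rho> \<in> ?H"
    using rotation_Bij[OF alpha_hat_props(4)[OF assms(1)]] rotation_image_Mult[OF assms(1)]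
    by simp
  then have "?\<rho> [^]\<^bsub>BijGroup ?S\<^esub> n \<in> ?H"
    using subgroup_setwise_stabilizer[OF frobenius_axioms(4)[OF assms(1)]]
    by (intro group.subgroup_int_pow_closed[OF group_BijGroup])
  \<comment> \<open>Read off from the simplicial set, the edges are the carrier and the edge triples
    of triangles are exactly \<open>Mult F\<close>.\<close>
  then show "(rotation E (alpha_hat F) [^]\<^bsub>BijGroup (E \<times> E \<times> E)\<^esub> n)
           ` (triangle_edges \<X> ` simplices \<X> 2) = triangle_edges \<X> ` simplices \<X> 2"
    unfolding E_def \<X>_def edge_set_frobenius triangle_edges_frobenius by simp
qed

end
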